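(* For the Rudin--Shapiro word, for all integers $n\ge 0$, $i(2^n)=7\cdot 2^n$.
   Context: The Rudin--Shapiro word $\mathbf r=(r_i)_{i\ge0}=\mathtt{0001001000011101}\cdots$ is the image, under the coding $\mathtt a,\mathtt b\mapsto\mathtt 0$ and $\mathtt c,\mathtt d\mapsto\mathtt 1$, of the fixed point starting with $\mathtt a$ of the substitution $\mathtt a\mapsto\mathtt{ab},\ \mathtt b\mapsto\mathtt{ac},\ \mathtt c\mapsto\mathtt{db},\ \mathtt d\mapsto\mathtt{dc}$. A monochromatic arithmetic progression (MAP) of difference $d$ and length $\ell$ in $\mathbf r$ starting at position $j\ge0$ means $r_j=r_{j+d}=\cdots=r_{j+(\ell-1)d}$. For $d\ge1$, $A(d)$ is the maximum $\ell$ such that a MAP of difference $d$ and length $\ell$ occurs in $\mathbf r$ (with $A(d)=\infty$ if no finite maximum exists; it is known that $\mathbf r$ has no infinite MAP and that $A(2^n)=4$ for all $n\geq 0$), and $i(d)=\min\{j\ge0 : r_j=r_{j+d}=\cdots=r_{j+(A(d)-1)d}\}$ is the first position at which a MAP of difference $d$ and maximal length $A(d)$ starts. *)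

theory Defs
  imports Main "HOL-Library.Extended_Nat"
begin

datatype letter = La | Lb | Lc | Ld

fun rs_subst :: "letter \<Rightarrow> letter list" where
  "rs_subst La = [La, Lb]"
| "rs_subst Lb = [La, Lc]"
| "rs_subst Lc = [Ld, Lb]"
| "rs_subst Ld = [Ld, Lc]"

text \<open>
  Infinite words are functions on the natural numbers. Every letter has an image of length 2,
  so the infinite concatenation of the images of w 0, w 1, ... has at position n the letter
  number n mod 2 of the image of w (n div 2).
\<close>

definition rs_subst_word :: "(nat \<Rightarrow> letter) \<Rightarrow> nat \<Rightarrow> letter" where
  "rs_subst_word w n = rs_subst (w (n div 2)) ! (n mod 2)"

definition rs_fixpoint :: "nat \<Rightarrow> letter" where
  "rs_fixpoint = (THE w. w 0 = La \<and> rs_subst_word w = w)"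

fun rs_coding :: "letter \<Rightarrow> nat" where
  "rs_coding La = 0"
| "rs_coding Lb = 0"
| "rs_coding Lc = 1"
| "rs_coding Ld = 1"

definition rudin_shapiro :: "nat \<Rightarrow> nat" where
  "rudin_shapiro n = rs_coding (rs_fixpoint n)"

text \<open>The length is an extended natural number, so that infinite progressions are covered.\<close>

definition is_MAP :: "nat \<Rightarrow> enat \<Rightarrow> nat \<Rightarrow> bool" where
  "is_MAP d l j \<longleftrightarrow> (\<forall>k. enat k < l \<longrightarrow> rudin_shapiro (j + k * d) = rudin_shapiro j)"

text \<open>
  The supremum of a nonempty set of finite lengths is its maximum if the set is bounded, and
  infinite otherwise.
\<close>

definition max_MAP_length :: "nat \<Rightarrow> enat" where
  "max_MAP_length d = Sup {enat l | l. \<exists>j. is_MAP d (enat l) j}"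

definition first_max_MAP :: "nat \<Rightarrow> nat" where
  "first_max_MAP d = (LEAST j. is_MAP d (max_MAP_length d) j)"


text \<open>The fixed point exists and is unique, so the definite description above is proper.\<close>

fun rs_word :: "nat \<Rightarrow> letter" where
  "rs_word n = (if n = 0 then La else rs_subst (rs_word (n div 2)) ! (n mod 2))"

declare rs_word.simps [simp del]

lemma rs_word_fixpoint: "rs_word 0 = La \<and> rs_subst_word rs_word = rs_word"
proof -
  have "rs_subst_word rs_word n = rs_word n" for n
    by (cases "n = 0") (simp_all add: rs_subst_word_def rs_word.simps[of n] rs_word.simps[of 0])
  then show ?thesis
    by (auto simp: rs_word.simps[of 0])
qed

lemma rs_fixpoint_unique:
  assumes "w 0 = La" "rs_subst_word w = w"
  shows "w = rs_word"
proof
  fix n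
  show "w n = rs_word n"
  proof (induction n rule: less_induct)
    case (less n)
    show ?case
    proof (cases "n = 0")
      case True
      then show ?thesis using assms(1) by (simp add: rs_word.simps)
    next
      case False
      have "w n = rs_subst (w (n div 2)) ! (n mod 2)"
        using fun_cong[OF assms(2), of n] by (simp add: rs_subst_word_def)
      also have "w (n div 2) = rs_word (n div 2)"
        using False by (intro less) simp
      finally show ?thesis
        using False by (simp add: rs_word.simps[of n])
    qed
  qed
qed

lemma rs_fixpoint_eq: "rs_fixpoint = rs_word"
  unfolding rs_fixpoint_def
  by (rule the_equality) (use rs_word_fixpoint rs_fixpoint_unique in auto)

lemma rs_fixpoint_fixed: "rs_fixpoint 0 = La" "rs_subst_word rs_fixpoint = rs_fixpoint"
  using rs_word_fixpoint by (simp_all add: rs_fixpoint_eq)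

lemma rudin_shapiro_prefix:
  "map rudin_shapiro [0..<16] = [0,0,0,1,0,0,1,0,0,0,0,1,1,1,0,1]"
  by (simp add: upt_rec rudin_shapiro_def rs_fixpoint_eq rs_word.simps)

end

theory Submission
  imports Defs
begin

text \<open>
  Modulo 2, the sequence satisfies r(2q) = r(q) and r(2q+1) = r(q) + q. Iterating, for fixed
  s < 2^n the subsequence r(q 2^n + s) is, up to a constant, either r(q) or r(q) + q. A MAP of
  difference 2^n therefore corresponds to a block of consecutive equal values in one of these two
  sequences. In r the values at 4m+2 and 4m+3 always differ, in r(q) + q those at 4m and 4m+1
  always differ; so such blocks have length at most 4, and inspection of the first few values shows
  that none of length 4 starts before q = 7.
\<close>

lemma rs_fixpoint_rec: "rs_fixpoint n = rs_subst (rs_fixpoint (n div 2)) ! (n mod 2)"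
  using fun_cong[OF rs_fixpoint_fixed(2), of n] by (simp add: rs_subst_word_def)

text \<open>Every image under the substitution has \<open>La\<close> or \<open>Ld\<close> first and
  \<open>Lb\<close> or \<open>Lc\<close> second, so a letter reveals the parity of its
  position.\<close>

lemma odd_position_iff: "odd n \<longleftrightarrow> rs_fixpoint n \<in> {Lb, Lc}"
  by (cases "rs_fixpoint (n div 2)"; cases n rule: parity_cases)
     (simp_all add: rs_fixpoint_rec[of n])

lemma rudin_shapiro_even: "rudin_shapiro (2 * n) = rudin_shapiro n"
  by (cases "rs_fixpoint n") (simp_all add: rudin_shapiro_def rs_fixpoint_rec[of "2 * n"])

lemma odd_rudin_shapiro_odd:
  "odd (rudin_shapiro (Suc (2 * n))) \<longleftrightarrow> odd (rudin_shapiro n) \<noteq> odd n"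
  using odd_position_iff[of n]
  by (cases "rs_fixpoint n") (simp_all add: rudin_shapiro_def rs_fixpoint_rec[of "Suc (2 * n)"])

text \<open>The flag merges r(q) and r(q) + q modulo 2 into one family, which is closed, up to
  complement, under passing to even or odd positions.\<close>

definition rs_twist :: "bool \<Rightarrow> nat \<Rightarrow> bool" where
  "rs_twist u q \<longleftrightarrow> odd (rudin_shapiro q) \<noteq> (u \<and> odd q)"

lemma rs_twist_double:
  "rs_twist u (2 * q) \<longleftrightarrow> rs_twist False q"
  "rs_twist u (Suc (2 * q)) \<longleftrightarrow> rs_twist True q \<noteq> u"
  by (auto simp: rs_twist_def rudin_shapiro_even odd_rudin_shapiro_odd)

text \<open>Induction on \<open>n\<close>, splitting off the top bit of \<open>s\<close> and
  absorbing it into the index as \<open>2 * q\<close> or \<open>Suc (2 * q)\<close>.\<close>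

lemma rudin_shapiro_block:
  assumes "s < 2 ^ n"
  shows "\<exists>u b. \<forall>q. odd (rudin_shapiro (q * 2 ^ n + s)) \<longleftrightarrow> rs_twist u q \<noteq> b"
  using assms
proof (induction n arbitrary: s)
  case 0
  then show ?case by (intro exI[of _ False]) (simp add: rs_twist_def)
next
  case (Suc n)
  show ?case
  proof (cases "s < 2 ^ n")
    case True
    from Suc.IH[OF this] obtain u b
      where *: "\<forall>q. odd (rudin_shapiro (q * 2 ^ n + s)) \<longleftrightarrow> rs_twist u q \<noteq> b"
      by (elim exE)
    have "q * 2 ^ Suc n + s = 2 * q * 2 ^ n + s" for q
      by simp
    then have "odd (rudin_shapiro (q * 2 ^ Suc n + s)) \<longleftrightarrow> rs_twist False q \<noteq> b" for q
      using *[rule_format, of "2 * q"] by (simp only: rs_twist_double)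
    then show ?thesis by (intro exI[of _ False] exI[of _ b] allI)
  next
    case False
    with Suc.prems have "s - 2 ^ n < 2 ^ n" by simp
    from Suc.IH[OF this] obtain u b
      where *: "\<forall>q. odd (rudin_shapiro (q * 2 ^ n + (s - 2 ^ n))) \<longleftrightarrow> rs_twist u q \<noteq> b"
      by (elim exE)
    have "q * 2 ^ Suc n + s = Suc (2 * q) * 2 ^ n + (s - 2 ^ n)" for q
      using False by (simp add: algebra_simps)
    \<comment> \<open>At odd indices the old flag \<open>u\<close> contributes only a constant, so
      it moves into the complement bit.\<close>
    then have "odd (rudin_shapiro (q * 2 ^ Suc n + s)) \<longleftrightarrow> rs_twist True q \<noteq> (u \<noteq> b)" for q
      using *[rule_format, of "Suc (2 * q)"] by (simp only: rs_twist_double) argo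
    then show ?thesis by (intro exI[of _ True] exI[of _ "u \<noteq> b"] allI)
  qed
qed

text \<open>The terms of the progression share one residue modulo \<open>2 ^ n\<close>, hence one
  \<open>u\<close> and one \<open>b\<close>, and \<open>b\<close> cancels on comparison.\<close>

lemma is_MAP_power2D:
  assumes "is_MAP (2 ^ n) (enat l) j"
  shows "\<exists>u. \<forall>k<l. rs_twist u (j div 2 ^ n + k) \<longleftrightarrow> rs_twist u (j div 2 ^ n)"
proof -
  define q s where "q = j div 2 ^ n" and "s = j mod 2 ^ n"
  have j: "j + k * 2 ^ n = (q + k) * 2 ^ n + s" for k
    by (simp add: q_def s_def algebra_simps)
  have "s < 2 ^ n" by (simp add: s_def)
  from rudin_shapiro_block[OF this] obtain u b
    where *: "\<forall>q. odd (rudin_shapiro (q * 2 ^ n + s)) \<longleftrightarrow> rs_twist u q \<noteq> b"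
    by (elim exE)
  have "rs_twist u (q + k) \<longleftrightarrow> rs_twist u q" if "k < l" for k
  proof -
    \<comment> \<open>The summand \<open>0 * 2 ^ n\<close> lets \<open>j\<close> rewrite both
      sides.\<close>
    have "rudin_shapiro (j + k * 2 ^ n) = rudin_shapiro (j + 0 * 2 ^ n)"
      using assms that by (simp add: is_MAP_def)
    then have "odd (rudin_shapiro ((q + k) * 2 ^ n + s)) \<longleftrightarrow>
        odd (rudin_shapiro ((q + 0) * 2 ^ n + s))"
      unfolding j by simp
    then show ?thesis unfolding *[rule_format] add_0_right by argo
  qed
  then show ?thesis unfolding q_def by (intro exI[of _ u]) simp
qed

text \<open>Both indices of each pair halve to the same number: the even \<open>2 * m\<close> in the
  first, the odd \<open>2 * m + 1\<close> in the second.\<close>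

lemma rudin_shapiro_quad:
  "odd (rudin_shapiro (4 * m + 1)) \<longleftrightarrow> odd (rudin_shapiro (4 * m))"
  "odd (rudin_shapiro (4 * m + 3)) \<longleftrightarrow> even (rudin_shapiro (4 * m + 2))"
proof -
  show "odd (rudin_shapiro (4 * m + 1)) \<longleftrightarrow> odd (rudin_shapiro (4 * m))"
    using odd_rudin_shapiro_odd[of "2 * m"] rudin_shapiro_even[of "2 * m"] by simp
  have "4 * m + 3 = Suc (2 * Suc (2 * m))" "4 * m + 2 = 2 * Suc (2 * m)" by simp_all
  then show "odd (rudin_shapiro (4 * m + 3)) \<longleftrightarrow> even (rudin_shapiro (4 * m + 2))"
    by (simp only: odd_rudin_shapiro_odd[of "Suc (2 * m)"] rudin_shapiro_even) simp
qed

lemma not_is_MAP_power2_5: "\<not> is_MAP (2 ^ n) (enat 5) j"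
proof
  assume "is_MAP (2 ^ n) (enat 5) j"
  then obtain u
    where u: "\<forall>k<5. rs_twist u (j div 2 ^ n + k) \<longleftrightarrow> rs_twist u (j div 2 ^ n)"
    by (elim is_MAP_power2D[elim_format] exE)
  define q where "q = j div 2 ^ n"
  have eq: "rs_twist u x \<longleftrightarrow> rs_twist u y"
    if "q \<le> x" "x < q + 5" "q \<le> y" "y < q + 5" for x y
    using u[rule_format, of "x - q"] u[rule_format, of "y - q"] that by (simp add: q_def)
  show False
  proof (cases u)
    case True
    \<comment> \<open>The least multiple of 4 from \<open>q\<close> on is at most
      \<open>q + 3\<close>, so its successor is still in the window.\<close>
    obtain m where "q \<le> 4 * m" "4 * m + 1 < q + 5"
      by (rule that[of "(q + 3) div 4"]) presburger+
    then show False
      using eq[of "4 * m" "4 * m + 1"] rudin_shapiro_quad(1)[of m] True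
      by (simp add: rs_twist_def)
  next
    case False
    \<comment> \<open>Likewise for the least number from \<open>q\<close> on that is 2 modulo
      4.\<close>
    obtain m where "q \<le> 4 * m + 2" "4 * m + 3 < q + 5"
      by (rule that[of "(q + 1) div 4"]) presburger+
    then show False
      using eq[of "4 * m + 2" "4 * m + 3"] rudin_shapiro_quad(2)[of m] False
      by (simp add: rs_twist_def)
  qed
qed

lemma rudin_shapiro_mult_power2: "rudin_shapiro (q * 2 ^ n) = rudin_shapiro q"
proof (induction n)
  case (Suc n)
  have "q * 2 ^ Suc n = 2 * (q * 2 ^ n)" by simp
  then show ?case using Suc by (simp only: rudin_shapiro_even)
qed simp

lemma rudin_shapiro_values:
  "rudin_shapiro 0 = 0" "rudin_shapiro (Suc 0) = 0" "rudin_shapiro 2 = 0" "rudin_shapiro 3 = 1"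
  "rudin_shapiro 4 = 0" "rudin_shapiro 5 = 0" "rudin_shapiro 6 = 1" "rudin_shapiro 7 = 0"
  "rudin_shapiro 8 = 0" "rudin_shapiro 9 = 0" "rudin_shapiro 10 = 0"
  using rudin_shapiro_prefix by (simp_all add: upt_rec numeral_eq_Suc)

text \<open>Multiplying the index by \<open>2 ^ n\<close> preserves values, and r vanishes at 7, 8,
  9 and 10.\<close>

lemma is_MAP_power2_4: "is_MAP (2 ^ n) (enat 4) (7 * 2 ^ n)"
proof -
  have "rudin_shapiro (7 * 2 ^ n + k * 2 ^ n) = rudin_shapiro (7 * 2 ^ n)" if "k < 4" for k
  proof -
    have "k \<in> {0, 1, 2, 3}" using that by auto
    then show ?thesis
      unfolding add_mult_distrib[symmetric] rudin_shapiro_mult_power2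
      by (auto simp: rudin_shapiro_values)
  qed
  then show ?thesis by (simp add: is_MAP_def)
qed

lemma is_MAP_power2_4_ge:
  assumes "is_MAP (2 ^ n) (enat 4) j"
  shows "7 * 2 ^ n \<le> j"
proof (rule ccontr)
  assume "\<not> ?thesis"
  then have "j div 2 ^ n < 7" by (simp add: div_less_iff_less_mult)
  then have q: "j div 2 ^ n \<in> {0, 1, 2, 3, 4, 5, 6}" by auto
  from is_MAP_power2D[OF assms] obtain u
    where u: "\<forall>k<4. rs_twist u (j div 2 ^ n + k) \<longleftrightarrow> rs_twist u (j div 2 ^ n)"
    by (elim exE)
  show False
    \<comment> \<open>Finite check: for either flag, each window of four starting at 0 to 6 contains
      a change.\<close>
    using q u[rule_format, of 1] u[rule_format, of 2] u[rule_format, of 3]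
    by (elim insertE) (simp_all add: rs_twist_def rudin_shapiro_values flip: numeral_2_eq_2)
qed

lemma max_MAP_length_power2: "max_MAP_length (2 ^ n) = enat 4"
  unfolding max_MAP_length_def
proof (rule antisym)
  have "l \<le> 4" if "is_MAP (2 ^ n) (enat l) j" for l j
  proof (rule ccontr)
    assume "\<not> l \<le> 4"
    \<comment> \<open>The first five terms of a longer MAP form a MAP.\<close>
    then have "is_MAP (2 ^ n) (enat 5) j" using that by (simp add: is_MAP_def)
    then show False using not_is_MAP_power2_5 by blast
  qed
  then show "Sup {enat l | l. \<exists>j. is_MAP (2 ^ n) (enat l) j} \<le> enat 4"
    by (intro Sup_least) auto
  show "enat 4 \<le> Sup {enat l | l. \<exists>j. is_MAP (2 ^ n) (enat l) j}"
    using is_MAP_power2_4 by (intro Sup_upper) blast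
qed

theorem proposition3p9:
  fixes n :: nat
  shows "first_max_MAP (2 ^ n) = 7 * 2 ^ n"
  unfolding first_max_MAP_def max_MAP_length_power2
  by (rule Least_equality) (fact is_MAP_power2_4, erule is_MAP_power2_4_ge)

end
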